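(* Let $v(x)={}^t\!xQx$ be a positive definite quadratic form on $\mathbb{R}^n$, let $M\subsetneq[n]$ and $\tau=\tau^{(M)}\in\mathbb{R}^M$. (i) For any $x\in h(\tau^{(M)})$ one has $v(x)\ge\gamma_M(\tau)$, and equality holds if and only if $x=c^{(M^c)}(\tau)$. (ii) The point $c^{(M^c)}(\tau)\in h(\tau^{(M)})$ is the foot of the $Q$-perpendicular from the origin $O$ to the affine subspace $h(\tau^{(M)})$, and one has $$\mathrm{dist}_Q(O,h(\tau^{(M)}))=\|c^{(M^c)}(\tau)\|_Q=\sqrt{\gamma_M(\tau)}.$$
   Context: $[n]=\{1,\dots,n\}$, $M^c=[n]\setminus M$; $Q$ is symmetric positive definite. $\langle x,y\rangle={}^t\!xQy$, $\|x\|_Q=\sqrt{\langle x,x\rangle}=\sqrt{v(x)}$, $\mathrm{dist}_Q(x,y)=\|x-y\|_Q$ (the distance to a set being the infimum); $Q$-perpendicular means orthogonal for $\langle\cdot,\cdot\rangle$. $h(\tau^{(M)})=\{x\in\mathbb{R}^n\mid x_j=\tau_j,\ j\in M\}$. $Q^{(M)}$ is the principal submatrix of $Q$ indexed by $M$ and $Q^{(M^c\times M)}$ the submatrix with rows in $M^c$, columns in $M$. $c^{(M^c)}(\tau)\in\mathbb{R}^n$ has $j$-th component $\tau_j$ for $j\in M$, and its components indexed by $M^c$ form the unique solution $c_{M^c}(\tau)=y$ of $Q^{(M^c)}y=-Q^{(M^c\times M)}\tau$. $\gamma_M(\tau)={}^t\tau Q^{(M)}\tau-{}^tc_{M^c}(\tau)Q^{(M^c)}c_{M^c}(\tau)$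 ($\gamma_\emptyset=0$). *)

theory Defs
  imports "HOL-Analysis.Analysis"
begin

text \<open>
  The index set \<open>[n]\<close> is the type \<open>'n\<close>. For \<open>M :: 'n set\<close>, the space \<open>\<real>\<^sup>M\<close> consists of the
  functions that take the value \<^term>\<open>undefined\<close> outside \<open>M\<close>.
\<close>

abbreviation coord_space :: "'n set \<Rightarrow> ('n \<Rightarrow> real) set" where
  "coord_space M \<equiv> M \<rightarrow>\<^sub>E UNIV"

definition sym_pos_def :: "real ^ 'n ^ 'n \<Rightarrow> bool" where
  "sym_pos_def Q \<longleftrightarrow> transpose Q = Q \<and> (\<forall>x. x \<noteq> 0 \<longrightarrow> 0 < x \<bullet> (Q *v x))"

definition quad_form :: "real ^ 'n ^ 'n \<Rightarrow> real ^ 'n \<Rightarrow> real" where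
  "quad_form Q x = x \<bullet> (Q *v x)"

definition inner_Q :: "real ^ 'n ^ 'n \<Rightarrow> real ^ 'n \<Rightarrow> real ^ 'n \<Rightarrow> real" where
  "inner_Q Q x y = x \<bullet> (Q *v y)"

definition norm_Q :: "real ^ 'n ^ 'n \<Rightarrow> real ^ 'n \<Rightarrow> real" where
  "norm_Q Q x = sqrt (inner_Q Q x x)"

definition dist_Q :: "real ^ 'n ^ 'n \<Rightarrow> real ^ 'n \<Rightarrow> real ^ 'n \<Rightarrow> real" where
  "dist_Q Q x y = norm_Q Q (x - y)"

definition infdist_Q :: "real ^ 'n ^ 'n \<Rightarrow> real ^ 'n \<Rightarrow> (real ^ 'n) set \<Rightarrow> real" where
  "infdist_Q Q x A = (INF y\<in>A. dist_Q Q x y)"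

text \<open>For points \<open>y\<close>, \<open>z\<close> of an affine subspace, \<open>y - z\<close> runs through its directions.\<close>

definition is_foot_Q :: "real ^ 'n ^ 'n \<Rightarrow> real ^ 'n \<Rightarrow> (real ^ 'n) set \<Rightarrow> real ^ 'n \<Rightarrow> bool" where
  "is_foot_Q Q x A p \<longleftrightarrow> p \<in> A \<and> (\<forall>y\<in>A. \<forall>z\<in>A. inner_Q Q (p - x) (y - z) = 0)"

definition coord_slice :: "'n set \<Rightarrow> ('n \<Rightarrow> real) \<Rightarrow> (real ^ 'n) set" where
  "coord_slice M \<tau> = {x. \<forall>j\<in>M. x $ j = \<tau> j}"

text \<open>
  \<open>block_mult Q I J y\<close> is the product in \<open>\<real>\<^sup>I\<close> of the submatrix of \<open>Q\<close> with rows in \<open>I\<close> and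
  columns in \<open>J\<close> with the vector \<open>y \<in> \<real>\<^sup>J\<close>.
\<close>

definition block_mult ::
  "real ^ 'n ^ 'n \<Rightarrow> 'n set \<Rightarrow> 'n set \<Rightarrow> ('n \<Rightarrow> real) \<Rightarrow> 'n \<Rightarrow> real" where
  "block_mult Q I J y = (\<lambda>i\<in>I. \<Sum>j\<in>J. Q $ i $ j * y j)"

definition block_form :: "real ^ 'n ^ 'n \<Rightarrow> 'n set \<Rightarrow> ('n \<Rightarrow> real) \<Rightarrow> real" where
  "block_form Q I y = (\<Sum>i\<in>I. y i * block_mult Q I I y i)"

definition c_compl :: "real ^ 'n ^ 'n \<Rightarrow> 'n set \<Rightarrow> ('n \<Rightarrow> real) \<Rightarrow> 'n \<Rightarrow> real" where
  "c_compl Q M \<tau> =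
     (THE y. y \<in> coord_space (- M) \<and>
        block_mult Q (- M) (- M) y = (\<lambda>i\<in>- M. - block_mult Q (- M) M \<tau> i))"

definition c_point :: "real ^ 'n ^ 'n \<Rightarrow> 'n set \<Rightarrow> ('n \<Rightarrow> real) \<Rightarrow> real ^ 'n" where
  "c_point Q M \<tau> = (\<chi> j. if j \<in> M then \<tau> j else c_compl Q M \<tau> j)"

definition gamma_Q :: "real ^ 'n ^ 'n \<Rightarrow> 'n set \<Rightarrow> ('n \<Rightarrow> real) \<Rightarrow> real" where
  "gamma_Q Q M \<tau> = block_form Q M \<tau> - block_form Q (- M) (c_compl Q M \<tau>)"

lemma affine_coord_slice: "affine (coord_slice M \<tau>)"
  by (auto simp: affine_def coord_slice_def distrib_right[symmetric])

lemma ex1_c_compl: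
  fixes Q :: "real ^ 'n ^ 'n"
  assumes "sym_pos_def Q"
  shows "\<exists>!y. y \<in> coord_space (- M) \<and>
           block_mult Q (- M) (- M) y = (\<lambda>i\<in>- M. - block_mult Q (- M) M \<tau> i)"
proof -
  define f :: "real ^ 'n \<Rightarrow> real ^ 'n" where
    "f x = (\<chi> i. if i \<in> M then x $ i else \<Sum>j\<in>- M. Q $ i $ j * x $ j)" for x
  have lin: "linear f"
    by (rule linearI)
      (auto simp: f_def vec_eq_iff algebra_simps sum.distrib sum_distrib_left)
  have ker: "x = 0" if "f x = 0" for x
  proof (rule ccontr)
    assume "x \<noteq> 0"
    have M: "x $ i = 0" if "i \<in> M" for i
      using \<open>f x = 0\<close> that by (auto simp: f_def vec_eq_iff split: if_splits)
    have C: "(\<Sum>j\<in>- M. Q $ i $ j * x $ j) = 0" if "i \<notin> M" for i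
      using \<open>f x = 0\<close> that by (auto simp: f_def vec_eq_iff split: if_splits)
    have "(Q *v x) $ i = (\<Sum>j\<in>- M. Q $ i $ j * x $ j)" for i
      unfolding matrix_vector_mult_def using M by (auto intro!: sum.mono_neutral_right)
    then have "x $ i * (Q *v x) $ i = 0" for i
      using M[of i] C[of i] by (cases "i \<in> M") simp_all
    then have "x \<bullet> (Q *v x) = 0"
      by (simp only: inner_vec_def inner_real_def sum.neutral_const)
    with assms \<open>x \<noteq> 0\<close> show False
      by (auto simp: sym_pos_def_def)
  qed
  have inj: "inj f"
    using lin ker by (simp add: linear_injective_0)
  have "surj f"
    using lin inj by (rule linear_injective_imp_surjective) simp
  define b :: "real ^ 'n" where "b = (\<chi> i. if i \<in> M then 0 else - (\<Sum>j\<in>M. Q $ i $ j * \<tau> j))"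
  obtain x where x: "f x = b"
    using surjD[OF \<open>surj f\<close>, of b] by (elim exE) (rule that, rule sym)
  have sol: "(\<Sum>j\<in>- M. Q $ i $ j * x $ j) = - (\<Sum>j\<in>M. Q $ i $ j * \<tau> j)" if "i \<notin> M" for i
    using arg_cong[OF x, of "\<lambda>z. z $ i"] that by (simp add: f_def b_def)
  show ?thesis
  proof (rule ex1I[of _ "\<lambda>i\<in>- M. x $ i"], intro conjI)
    show "(\<lambda>i\<in>- M. x $ i) \<in> coord_space (- M)"
      by simp
    show "block_mult Q (- M) (- M) (\<lambda>i\<in>- M. x $ i) = (\<lambda>i\<in>- M. - block_mult Q (- M) M \<tau> i)"
      unfolding block_mult_def by (rule restrict_ext) (simp add: sol)
  next
    fix y assume y: "y \<in> coord_space (- M) \<and>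
      block_mult Q (- M) (- M) y = (\<lambda>i\<in>- M. - block_mult Q (- M) M \<tau> i)"
    let ?z = "\<chi> i. if i \<in> M then 0 else y i"
    have "(\<Sum>j\<in>- M. Q $ i $ j * y j) = - (\<Sum>j\<in>M. Q $ i $ j * \<tau> j)" if "i \<notin> M" for i
      using fun_cong[OF conjunct2[OF y], of i] that by (simp add: block_mult_def)
    then have "f ?z = f x"
      unfolding x by (simp add: f_def b_def vec_eq_iff)
    then have "?z = x"
      using inj by (simp add: inj_eq)
    then have "x $ i = y i" if "i \<notin> M" for i
      using that by auto
    then show "y = (\<lambda>i\<in>- M. x $ i)"
      using y by (intro extensionalityI[of _ "- M"]) (auto simp: PiE_def)
  qed
qed

lemma gamma_Q_empty:
  fixes Q :: "real ^ 'n ^ 'n"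
  assumes "sym_pos_def Q"
  shows "gamma_Q Q {} \<tau> = 0"
proof -
  have "c_compl Q {} \<tau> = (\<lambda>_. 0)"
    unfolding c_compl_def
    by (rule the1_equality[OF ex1_c_compl[OF assms]]) (simp add: block_mult_def)
  then show ?thesis
    by (simp add: gamma_Q_def block_form_def)
qed

end

theory Submission
  imports Defs
begin

text \<open>
  The defining equations of \<open>c = c_point Q M \<tau>\<close> say that \<open>Q c\<close> vanishes at all coordinates outside
  \<open>M\<close>, while the difference of two points of the slice vanishes on \<open>M\<close>. So \<open>c\<close> is
  \<open>Q\<close>-orthogonal to the slice, and Pythagoras gives \<open>v(x) = v(c) + v(x - c)\<close> for \<open>x\<close> in the slice.
\<close>

lemma inner_Q_commute:
  assumes "sym_pos_def Q"
  shows "inner_Q Q x y = inner_Q Q y x"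
proof -
  have "inner_Q Q x y = (transpose Q *v x) \<bullet> y"
    by (simp add: inner_Q_def dot_lmul_matrix[symmetric])
  also have "\<dots> = inner_Q Q y x"
    using assms by (simp add: sym_pos_def_def inner_Q_def inner_commute)
  finally show ?thesis .
qed

lemma inner_Q_self_pos:
  assumes "sym_pos_def Q" and "x \<noteq> 0"
  shows "0 < inner_Q Q x x"
  using assms by (simp add: sym_pos_def_def inner_Q_def)

lemma inner_Q_self_eq_0:
  assumes "sym_pos_def Q" and "inner_Q Q x x = 0"
  shows "x = 0"
  using inner_Q_self_pos[OF assms(1), of x] assms(2) by fastforce

lemma inner_Q_self_nonneg:
  assumes "sym_pos_def Q"
  shows "0 \<le> inner_Q Q x x"
  using inner_Q_self_pos[OF assms, of x] by (cases "x = 0") (auto simp: inner_Q_def)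

lemma inner_Q_diff_left: "inner_Q Q (x - y) z = inner_Q Q x z - inner_Q Q y z"
  by (simp add: inner_Q_def inner_diff_left)

lemma inner_Q_diff_right: "inner_Q Q x (y - z) = inner_Q Q x y - inner_Q Q x z"
  by (simp add: inner_Q_def matrix_vector_mult_diff_distrib inner_diff_right)

lemma quad_form_eq_inner_Q: "quad_form Q x = inner_Q Q x x"
  by (simp add: quad_form_def inner_Q_def)

lemma norm_Q_eq_sqrt: "norm_Q Q x = sqrt (quad_form Q x)"
  by (simp add: norm_Q_def quad_form_eq_inner_Q)

text \<open>The two sign changes cancel by bilinearity. This turns the infimum of distances from the
  origin into an infimum of norms.\<close>

lemma dist_Q_0: "dist_Q Q 0 x = norm_Q Q x"
proof -
  have "inner_Q Q (0 - x) (0 - x) = inner_Q Q x x"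
    unfolding inner_Q_diff_left inner_Q_diff_right by (simp add: inner_Q_def)
  then show ?thesis
    by (simp only: dist_Q_def norm_Q_def)
qed

lemma sum_UNIV_split:
  fixes f :: "'n::finite \<Rightarrow> real"
  shows "sum f UNIV = sum f M + sum f (- M)"
  using sum.union_disjoint[of M "- M" f] by simp

text \<open>By \<open>ex1_c_compl\<close> the definite description satisfies its defining property;
  evaluating it at a row outside \<open>M\<close> removes the restrictions.\<close>

lemma c_compl_equation:
  assumes "sym_pos_def Q" and "i \<notin> M"
  shows "(\<Sum>j\<in>- M. Q $ i $ j * c_compl Q M \<tau> j) = - (\<Sum>j\<in>M. Q $ i $ j * \<tau> j)"
proof -
  have "block_mult Q (- M) (- M) (c_compl Q M \<tau>) = (\<lambda>i\<in>- M. - block_mult Q (- M) M \<tau> i)"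
    using theI'[OF ex1_c_compl[OF assms(1)]] unfolding c_compl_def by blast
  from fun_cong[OF this, of i] show ?thesis
    using assms(2) by (simp add: block_mult_def)
qed

text \<open>Needed for both kinds of rows: outside \<open>M\<close> the two sums cancel, and inside
  \<open>M\<close> they give the block form of \<tau> and a mixed term.\<close>

lemma mult_c_point_component:
  "(Q *v c_point Q M \<tau>) $ i =
     (\<Sum>j\<in>M. Q $ i $ j * \<tau> j) + (\<Sum>j\<in>- M. Q $ i $ j * c_compl Q M \<tau> j)"
  unfolding matrix_vector_mult_def
  by (simp add: sum_UNIV_split[of _ M] c_point_def)

lemma mult_c_point_eq_0:
  assumes "sym_pos_def Q" and "i \<notin> M"
  shows "(Q *v c_point Q M \<tau>) $ i = 0"
  by (simp add: mult_c_point_component c_compl_equation[OF assms])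

lemma c_point_in_coord_slice: "c_point Q M \<tau> \<in> coord_slice M \<tau>"
  by (simp add: c_point_def coord_slice_def)

lemma inner_Q_c_point_diff:
  assumes "sym_pos_def Q" and "y \<in> coord_slice M \<tau>" and "z \<in> coord_slice M \<tau>"
  shows "inner_Q Q (c_point Q M \<tau>) (y - z) = 0"
proof -
  have "(y - z) $ i * (Q *v c_point Q M \<tau>) $ i = 0" for i
    using assms(2,3) mult_c_point_eq_0[OF assms(1), of i M \<tau>]
    by (cases "i \<in> M") (simp_all add: coord_slice_def)
  then have "inner_Q Q (y - z) (c_point Q M \<tau>) = 0"
    by (simp only: inner_Q_def inner_vec_def inner_real_def sum.neutral_const)
  then show ?thesis
    by (simp add: inner_Q_commute[OF assms(1)])
qed

text \<open>Rows outside \<open>M\<close> contribute nothing, so a mixed term remains beside the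
  block form of \<tau>. Symmetry of \<open>Q\<close> and the equation for \<open>c_compl\<close>
  turn it into the subtracted term of \<open>gamma_Q\<close>.\<close>

lemma quad_form_c_point:
  assumes "sym_pos_def Q"
  shows "quad_form Q (c_point Q M \<tau>) = gamma_Q Q M \<tau>"
proof -
  let ?c = "c_compl Q M \<tau>"
  \<comment> \<open>\<open>c_point\<close> is unfolded only after the rows outside \<open>M\<close>
    are gone, since \<open>mult_c_point_eq_0\<close> matches it folded.\<close>
  have "quad_form Q (c_point Q M \<tau>) = (\<Sum>i\<in>M. \<tau> i * (Q *v c_point Q M \<tau>) $ i)"
    by (simp add: quad_form_def inner_vec_def sum_UNIV_split[of _ M] mult_c_point_eq_0[OF assms])
      (simp add: c_point_def)
  also have "\<dots> = block_form Q M \<tau> + (\<Sum>i\<in>M. \<tau> i * (\<Sum>j\<in>- M. Q $ i $ j * ?c j))"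
    by (simp add: mult_c_point_component block_form_def block_mult_def distrib_left sum.distrib)
  also have "(\<Sum>i\<in>M. \<tau> i * (\<Sum>j\<in>- M. Q $ i $ j * ?c j)) =
      (\<Sum>j\<in>- M. ?c j * (\<Sum>i\<in>M. Q $ j $ i * \<tau> i))"
  proof -
    have "transpose Q $ i $ j = Q $ j $ i" for i j
      by (simp add: transpose_def)
    then have "Q $ i $ j = Q $ j $ i" for i j
      using assms by (simp add: sym_pos_def_def)
    then show ?thesis
      unfolding sum_distrib_left by (subst sum.swap) (simp add: mult_ac)
  qed
  also have "\<dots> = - block_form Q (- M) ?c"
    by (simp add: block_form_def block_mult_def c_compl_equation[OF assms] sum_negf)
  finally show ?thesis
    by (simp add: gamma_Q_def)
qed

lemma quad_form_coord_slice:
  assumes "sym_pos_def Q" and "x \<in> coord_slice M \<tau>"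
  shows "quad_form Q x =
    gamma_Q Q M \<tau> + inner_Q Q (x - c_point Q M \<tau>) (x - c_point Q M \<tau>)"
  using inner_Q_c_point_diff[OF assms c_point_in_coord_slice] quad_form_c_point[OF assms(1), of M \<tau>]
    inner_Q_commute[OF assms(1), of x "c_point Q M \<tau>"]
  by (simp add: quad_form_eq_inner_Q inner_Q_diff_left inner_Q_diff_right)

text \<open>For uniqueness, \<open>p - c\<close> is a direction of the slice and both
  \<open>p\<close> and \<open>c\<close> are orthogonal to it, so it is orthogonal to itself and
  vanishes.\<close>

lemma is_foot_Q_iff_c_point:
  assumes "sym_pos_def Q"
  shows "is_foot_Q Q 0 (coord_slice M \<tau>) p \<longleftrightarrow> p = c_point Q M \<tau>" (is "_ \<longleftrightarrow> p = ?c")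
proof
  assume "is_foot_Q Q 0 (coord_slice M \<tau>) p"
  then have p: "p \<in> coord_slice M \<tau>" and "inner_Q Q p (p - ?c) = 0"
    by (simp_all add: is_foot_Q_def c_point_in_coord_slice)
  then have "inner_Q Q (p - ?c) (p - ?c) = 0"
    by (simp add: inner_Q_diff_left[of Q p] inner_Q_c_point_diff[OF assms p c_point_in_coord_slice])
  from inner_Q_self_eq_0[OF assms this] show "p = ?c"
    by simp
next
  assume "p = ?c"
  then show "is_foot_Q Q 0 (coord_slice M \<tau>) p"
    by (simp add: is_foot_Q_def c_point_in_coord_slice inner_Q_c_point_diff[OF assms])
qed

theorem corollary2p2p5:
  fixes Q :: "real ^ 'n ^ 'n" and M :: "'n set" and \<tau> :: "'n \<Rightarrow> real"
  assumes "sym_pos_def Q" and "M \<subset> UNIV" and "\<tau> \<in> coord_space M"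
  shows
    "(\<forall>x\<in>coord_slice M \<tau>.
        quad_form Q x \<ge> gamma_Q Q M \<tau> \<and>
        (quad_form Q x = gamma_Q Q M \<tau> \<longleftrightarrow> x = c_point Q M \<tau>)) \<and>
     c_point Q M \<tau> \<in> coord_slice M \<tau> \<and>
     (\<forall>p. is_foot_Q Q 0 (coord_slice M \<tau>) p \<longleftrightarrow> p = c_point Q M \<tau>) \<and>
     infdist_Q Q 0 (coord_slice M \<tau>) = norm_Q Q (c_point Q M \<tau>) \<and>
     norm_Q Q (c_point Q M \<tau>) = sqrt (gamma_Q Q M \<tau>)"
proof -
  let ?c = "c_point Q M \<tau>"
  have min: "gamma_Q Q M \<tau> \<le> quad_form Q x" if "x \<in> coord_slice M \<tau>" for x
    using quad_form_coord_slice[OF assms(1) that] inner_Q_self_nonneg[OF assms(1)] by simp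
  have eq: "quad_form Q x = gamma_Q Q M \<tau> \<longleftrightarrow> x = ?c" if "x \<in> coord_slice M \<tau>" for x
    using quad_form_coord_slice[OF assms(1) that] quad_form_c_point[OF assms(1), of M \<tau>]
      inner_Q_self_eq_0[OF assms(1), of "x - ?c"] by auto
  have norm_c: "norm_Q Q ?c = sqrt (gamma_Q Q M \<tau>)"
    by (simp add: norm_Q_eq_sqrt quad_form_c_point[OF assms(1)])
  have "infdist_Q Q 0 (coord_slice M \<tau>) = norm_Q Q ?c"
    unfolding infdist_Q_def dist_Q_0
  \<comment> \<open>The infimum is attained at \<open>c\<close>; the lower bound follows from
    \<open>min\<close> by monotonicity of the square root.\<close>
  proof (rule cInf_eq_minimum)
    show "norm_Q Q ?c \<in> norm_Q Q ` coord_slice M \<tau>"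
      using c_point_in_coord_slice by blast
    show "norm_Q Q ?c \<le> r" if "r \<in> norm_Q Q ` coord_slice M \<tau>" for r
      using that min norm_c by (auto simp: norm_Q_eq_sqrt)
  qed
  with min eq norm_c show ?thesis
    by (simp add: c_point_in_coord_slice is_foot_Q_iff_c_point[OF assms(1)])
qed

end
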